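(* Let $f(\rho)=\operatorname{Tr}[\rho\,\Omega(\rho)]$ be convex and differentiable on $\mathcal M$, let $f_*:=\min_{\sigma\in\mathcal M}f(\sigma)$, let $E_1,\dots,E_m$ be a Hilbert–Schmidt orthonormal basis of $T_{\mathcal M}$, and let $\rho\in\mathcal M_{++}$. For $j=1,\dots,m$ let $h_j>0$ be such that $\rho\pm h_jE_j\in\mathcal M$, and define $$l_j:=\frac{f(\rho)-f(\rho-h_jE_j)}{h_j},\qquad u_j:=\frac{f(\rho+h_jE_j)-f(\rho)}{h_j},\qquad \beta_j:=\max\{|l_j|,|u_j|\}.$$ Then $$l_j\le Df(\rho)[E_j]\le u_j\quad (j=1,\dots,m),\qquad \epsilon(\rho)\le\Big(\sum_{j=1}^m\beta_j^2\Big)^{1/2},$$ and consequently $$0\le f(\rho)-f_*\le R_{\mathcal M}(\rho)\Big(\sum_{j=1}^m\beta_j^2\Big)^{1/2},$$ where $\epsilon(\rho):=\operatorname{dist}_2(\nabla f(\rho),N_{\mathcal M})$ and $R_{\mathcal M}(\rho):=\sup_{\sigma\in\mathcal M}\|\rho-\sigma\|_2$.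
   Context: $\mathcal H$ is a finite-dimensional complex Hilbert space, $\mathcal B(\mathcal H)$ the real space of Hermitian operators with Hilbert–Schmidt inner product $\langle X,Y\rangle=\operatorname{Tr}(XY)$ and norm $\|X\|_2=\sqrt{\operatorname{Tr}X^2}$, $\mathcal S(\mathcal H)$ the set of density operators. $H_1,\dots,H_k\in\mathcal B(\mathcal H)$ and $c\in\mathbb R^k$ are given, with $\{I,H_1,\dots,H_k\}$ linearly independent, and $\mathcal M=\{\rho\in\mathcal S(\mathcal H):\operatorname{Tr}(\rho H_j)=c_j,\ j=1,\dots,k\}$ is assumed to contain a positive-definite state; $\mathcal M_{++}=\{\rho\in\mathcal M:\rho\succ0\}$. $T_{\mathcal M}=\{X\in\mathcal B(\mathcal H):\operatorname{Tr}X=0,\ \operatorname{Tr}(XH_j)=0\ \forall j\}$, of dimension $m$, and $N_{\mathcal M}=T_{\mathcal M}^\perp=\operatorname{span}\{I,H_1,\dots,H_k\}$. $\Omega:\mathcal S(\mathcal H)\to\mathcal B(\mathcal H)$ is continuous. Differentiability of $f$ is relative to the affine hull of $\mathcal M$: $\nabla f(\rho)\in\mathcal B(\mathcal H)$ denotes an operator with $f(\sigma)=f(\rho)+\operatorname{Tr}[\nabla f(\rho)(\sigma-\rho)]+o(\|\sigma-\rho\|)$ as $\sigma\to\rho$ in $\mathcal M$ (determined up to adding elements of $N_{\mathcal M}$), and $Df(\rho)[X]=\operatorname{Tr}[\nabla f(\rho)X]$ for $X\in T_{\mathcal M}$. $\operatorname{dist}_2(Y,N_{\mathcal M})=\inf_{Z\in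 N_{\mathcal M}}\|Y-Z\|_2$. *)

theory Defs
  imports "HOL-Analysis.Analysis"
begin

text \<open>The Hilbert space is \<^typ>\<open>complex ^ 'n\<close> with its standard inner product; operators are square
  complex matrices, regarded as a real vector space.\<close>

type_synonym 'n oper = "complex ^ 'n ^ 'n"

definition adjoint_op :: "'n::finite oper \<Rightarrow> 'n oper" where
  "adjoint_op A = (\<chi> i j. cnj (A $ j $ i))"

definition hermitian_op :: "'n::finite oper \<Rightarrow> bool" where
  "hermitian_op A \<longleftrightarrow> adjoint_op A = A"

definition cinner :: "complex ^ 'n::finite \<Rightarrow> complex ^ 'n \<Rightarrow> complex" where
  "cinner v w = (\<Sum>i\<in>UNIV. cnj (v $ i) * w $ i)"

definition psd_op :: "'n::finite oper \<Rightarrow> bool" where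
  "psd_op A \<longleftrightarrow> hermitian_op A \<and> (\<forall>v. 0 \<le> Re (cinner v (A *v v)))"

definition pd_op :: "'n::finite oper \<Rightarrow> bool" where
  "pd_op A \<longleftrightarrow> hermitian_op A \<and> (\<forall>v. v \<noteq> 0 \<longrightarrow> 0 < Re (cinner v (A *v v)))"

text \<open>For Hermitian arguments the trace of the product is real, so \<^const>\<open>Re\<close> loses nothing.\<close>

definition hs_inner :: "'n::finite oper \<Rightarrow> 'n oper \<Rightarrow> real" where
  "hs_inner X Y = Re (trace (X ** Y))"

definition hs_norm :: "'n::finite oper \<Rightarrow> real" where
  "hs_norm X = sqrt (hs_inner X X)"

definition density_ops :: "'n::finite oper set" where
  "density_ops = {\<rho>. psd_op \<rho> \<and> trace \<rho> = 1}"

definition feas :: "nat \<Rightarrow> (nat \<Rightarrow> 'n::finite oper) \<Rightarrow> (nat \<Rightarrow> real) \<Rightarrow> 'n oper set" where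
  "feas k H c = {\<rho> \<in> density_ops. \<forall>j\<in>{1..k}. trace (\<rho> ** H j) = complex_of_real (c j)}"

definition feas_pd :: "nat \<Rightarrow> (nat \<Rightarrow> 'n::finite oper) \<Rightarrow> (nat \<Rightarrow> real) \<Rightarrow> 'n oper set" where
  "feas_pd k H c = {\<rho> \<in> feas k H c. pd_op \<rho>}"

definition tangent :: "nat \<Rightarrow> (nat \<Rightarrow> 'n::finite oper) \<Rightarrow> 'n oper set" where
  "tangent k H = {X. hermitian_op X \<and> trace X = 0 \<and> (\<forall>j\<in>{1..k}. trace (X ** H j) = 0)}"

text \<open>The orthogonal complement is taken inside the Hermitian operators.\<close>

definition normal_sp :: "nat \<Rightarrow> (nat \<Rightarrow> 'n::finite oper) \<Rightarrow> 'n oper set" where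
  "normal_sp k H = {Z. hermitian_op Z \<and> (\<forall>X\<in>tangent k H. hs_inner Z X = 0)}"

text \<open>The family \<open>I, H 1, \<dots>, H k\<close>, with the identity at index \<open>0\<close>.\<close>

definition with_id :: "(nat \<Rightarrow> 'n::finite oper) \<Rightarrow> nat \<Rightarrow> 'n oper" where
  "with_id H j = (if j = 0 then mat 1 else H j)"

definition lin_indep_family :: "nat \<Rightarrow> (nat \<Rightarrow> 'n::finite oper) \<Rightarrow> bool" where
  "lin_indep_family k H \<longleftrightarrow> inj_on (with_id H) {0..k} \<and> independent (with_id H ` {0..k})"

definition hs_orthonormal_basis ::
    "nat \<Rightarrow> (nat \<Rightarrow> 'n::finite oper) \<Rightarrow> 'n oper set \<Rightarrow> bool" where
  "hs_orthonormal_basis m E T \<longleftrightarrow>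
     (\<forall>i\<in>{1..m}. E i \<in> T) \<and>
     (\<forall>i\<in>{1..m}. \<forall>j\<in>{1..m}. hs_inner (E i) (E j) = (if i = j then 1 else 0)) \<and>
     span (E ` {1..m}) = T"

definition mean_value :: "('n::finite oper \<Rightarrow> 'n oper) \<Rightarrow> 'n oper \<Rightarrow> real" where
  "mean_value \<Omega> \<rho> = Re (trace (\<rho> ** \<Omega> \<rho>))"

text \<open>\<open>G\<close> is a gradient of \<open>f\<close> at \<open>\<rho>\<close> relative to \<open>S\<close>; see \<open>has_gradient_in_iff\<close> below for the
  first-order expansion. On a feasible set it is not unique: any element of \<open>normal_sp\<close> can be added.\<close>

definition has_gradient_in ::
    "('n::finite oper \<Rightarrow> real) \<Rightarrow> 'n oper \<Rightarrow> 'n oper \<Rightarrow> 'n oper set \<Rightarrow> bool" where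
  "has_gradient_in f G \<rho> S \<longleftrightarrow>
     hermitian_op G \<and> (f has_derivative (\<lambda>X. hs_inner G X)) (at \<rho> within S)"

text \<open>Minimum of \<open>f\<close> on \<open>S\<close>, meaningful only if it is attained; see \<open>min_value_attained\<close> below.\<close>

definition min_value :: "('a \<Rightarrow> real) \<Rightarrow> 'a set \<Rightarrow> real" where
  "min_value f S = (LEAST y. y \<in> f ` S)"

definition dist2 :: "'n::finite oper \<Rightarrow> 'n oper set \<Rightarrow> real" where
  "dist2 Y N = (INF Z\<in>N. hs_norm (Y - Z))"

definition radius2 :: "'n::finite oper \<Rightarrow> 'n oper set \<Rightarrow> real" where
  "radius2 \<rho> S = (SUP \<sigma>\<in>S. hs_norm (\<rho> - \<sigma>))"

definition lower_quot :: "('n::finite oper \<Rightarrow> real) \<Rightarrow> 'n oper \<Rightarrow> real \<Rightarrow> 'n oper \<Rightarrow> real" where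
  "lower_quot f \<rho> h E = (f \<rho> - f (\<rho> - h *\<^sub>R E)) / h"

definition upper_quot :: "('n::finite oper \<Rightarrow> real) \<Rightarrow> 'n oper \<Rightarrow> real \<Rightarrow> 'n oper \<Rightarrow> real" where
  "upper_quot f \<rho> h E = (f (\<rho> + h *\<^sub>R E) - f \<rho>) / h"

definition quot_bound :: "('n::finite oper \<Rightarrow> real) \<Rightarrow> 'n oper \<Rightarrow> real \<Rightarrow> 'n oper \<Rightarrow> real" where
  "quot_bound f \<rho> h E = max \<bar>lower_quot f \<rho> h E\<bar> \<bar>upper_quot f \<rho> h E\<bar>"


subsection \<open>Sanity checks\<close>

lemma hermitian_op_nth: "hermitian_op A \<longleftrightarrow> (\<forall>i j. cnj (A $ j $ i) = A $ i $ j)"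
  by (auto simp: hermitian_op_def adjoint_op_def vec_eq_iff)

lemma hs_inner_eq_inner: "hermitian_op Y \<Longrightarrow> hs_inner X Y = X \<bullet> Y"
proof -
  assume "hermitian_op Y"
  then have Y: "Y $ j $ i = cnj (Y $ i $ j)" for i j
    by (simp add: hermitian_op_nth)
  have "Re (X $ i $ j * Y $ j $ i) = X $ i $ j \<bullet> Y $ i $ j" for i j
    by (subst Y[of i j]) (simp add: inner_complex_def)
  then show ?thesis
    by (simp add: hs_inner_def trace_def matrix_matrix_mult_def inner_vec_def del: times_complex.simps)
qed

lemma hs_norm_eq_norm: "hermitian_op X \<Longrightarrow> hs_norm X = norm X"
  by (simp add: hs_norm_def hs_inner_eq_inner norm_eq_sqrt_inner)

lemma subspace_hermitian: "subspace {X :: 'n::finite oper. hermitian_op X}"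
  by (auto simp: subspace_def hermitian_op_nth)

lemma hermitian_diff: "hermitian_op X \<Longrightarrow> hermitian_op Y \<Longrightarrow> hermitian_op (X - Y)"
  by (auto simp: hermitian_op_nth)

lemma trace_mult_real:
  fixes X Y :: "'n::finite oper"
  assumes "hermitian_op X" "hermitian_op Y"
  shows "trace (X ** Y) = complex_of_real (hs_inner X Y)"
proof -
  have "cnj (trace (X ** Y)) = trace (Y ** X)"
    using assms by (simp add: trace_def matrix_matrix_mult_def hermitian_op_nth mult.commute)
  also have "\<dots> = trace (X ** Y)" by (rule trace_mul_sym)
  finally show ?thesis
    by (simp add: hs_inner_def complex_eq_iff)
qed

lemma has_gradient_in_iff:
  "has_gradient_in f G \<rho> S \<longleftrightarrow> hermitian_op G \<and>
     (\<lambda>\<sigma>. f \<sigma> - (f \<rho> + hs_inner G (\<sigma> - \<rho>))) \<in> o[at \<rho> within S](\<lambda>\<sigma>. norm (\<sigma> - \<rho>))"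
proof -
  have "(f has_derivative (\<lambda>X. hs_inner G X)) (at \<rho> within S) \<longleftrightarrow>
      (\<lambda>\<sigma>. f \<sigma> - (f \<rho> + hs_inner G (\<sigma> - \<rho>))) \<in> o[at \<rho> within S](\<lambda>\<sigma>. norm (\<sigma> - \<rho>))"
    if G: "hermitian_op G"
  proof -
    have "hs_inner G X = X \<bullet> G" for X
      using hs_inner_eq_inner[OF G, of X] trace_mul_sym[of G X] by (simp only: hs_inner_def)
    then have eq: "hs_inner G = (\<lambda>X. X \<bullet> G)" by auto
    have bl: "bounded_linear (\<lambda>X. X \<bullet> G)" by (rule bounded_linear_inner_left)
    have ev: "eventually (\<lambda>\<sigma>. norm (\<sigma> - \<rho>) \<noteq> 0) (at \<rho> within S)"
      by (auto simp: eventually_at_filter)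
    have o: "(\<lambda>\<sigma>. f \<sigma> - (f \<rho> + (\<sigma> - \<rho>) \<bullet> G)) \<in> o[at \<rho> within S](\<lambda>\<sigma>. norm (\<sigma> - \<rho>))
      \<longleftrightarrow> ((\<lambda>\<sigma>. (f \<sigma> - (f \<rho> + (\<sigma> - \<rho>) \<bullet> G)) / norm (\<sigma> - \<rho>)) \<longlongrightarrow> 0) (at \<rho> within S)"
      by (rule iffI, erule smalloD_tendsto, erule smalloI_tendsto[OF _ ev])
    also have "\<dots> \<longleftrightarrow> ((\<lambda>\<sigma>. norm ((f \<sigma> - (f \<rho> + (\<sigma> - \<rho>) \<bullet> G)) / norm (\<sigma> - \<rho>))) \<longlongrightarrow> 0) (at \<rho> within S)"
      by (rule tendsto_norm_zero_iff[symmetric])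
    also have "\<dots> \<longleftrightarrow> (f has_derivative (\<lambda>X. X \<bullet> G)) (at \<rho> within S)"
      using bl by (simp add: has_derivative_iff_norm diff_diff_add)
    finally show ?thesis by (simp add: eq)
  qed
  then show ?thesis by (auto simp: has_gradient_in_def)
qed

lemma normal_sp_eq_span:
  fixes H :: "nat \<Rightarrow> 'n::finite oper"
  assumes herm: "\<And>j. j \<in> {1..k} \<Longrightarrow> hermitian_op (H j)"
  shows "normal_sp k H = span (with_id H ` {0..k})"
proof -
  let ?B = "with_id H ` {0..k}"
  have hB: "hermitian_op b" if "b \<in> ?B" for b
    using that herm by (auto simp: with_id_def hermitian_op_nth mat_def split: if_splits)
  have hS: "hermitian_op b" if "b \<in> span ?B" for b
    using span_minimal[OF _ subspace_hermitian, of ?B] hB that by auto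
  have tan: "X \<in> tangent k H \<longleftrightarrow> hermitian_op X \<and> (\<forall>b\<in>?B. X \<bullet> b = 0)" for X
  proof (cases "hermitian_op X")
    case True
    have "trace (X ** b) = 0 \<longleftrightarrow> X \<bullet> b = 0" if "b \<in> ?B" for b
      using trace_mult_real[OF True hB[OF that]] hs_inner_eq_inner[OF hB[OF that]] by simp
    then have "(\<forall>b\<in>?B. X \<bullet> b = 0) \<longleftrightarrow> (\<forall>b\<in>?B. trace (X ** b) = 0)" by auto
    also have "\<dots> \<longleftrightarrow> trace X = 0 \<and> (\<forall>j\<in>{1..k}. trace (X ** H j) = 0)"
      by (force simp: with_id_def split: if_splits)
    finally show ?thesis using True by (simp add: tangent_def)
  qed (simp add: tangent_def)
  show ?thesis
  proof (intro equalityI subsetI)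
    fix Z assume Z: "Z \<in> normal_sp k H"
    obtain P Q where P: "P \<in> span ?B" and Q: "\<And>w. w \<in> span ?B \<Longrightarrow> orthogonal Q w" and Zeq: "Z = P + Q"
      using orthogonal_subspace_decomp_exists[of ?B Z] by metis
    have "hermitian_op Q"
      using hermitian_diff[of Z P] Z hS[OF P] Zeq by (simp add: normal_sp_def)
    moreover have "\<forall>b\<in>?B. Q \<bullet> b = 0"
      using Q by (auto simp: orthogonal_def span_base)
    ultimately have QT: "Q \<in> tangent k H" by (simp add: tan)
    then have "Z \<bullet> Q = 0"
      using Z hs_inner_eq_inner[of Q Z] by (simp add: normal_sp_def tan)
    moreover have "P \<bullet> Q = 0" using Q[OF P] by (simp add: orthogonal_def inner_commute)
    ultimately have "Q = 0" using Zeq by (simp add: inner_add_left)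
    then show "Z \<in> span ?B" using P Zeq by simp
  next
    fix Z assume Z: "Z \<in> span ?B"
    have "hs_inner Z X = 0" if X: "X \<in> tangent k H" for X
    proof -
      have "orthogonal X Z"
      proof (rule orthogonal_to_span[OF Z])
        fix b assume "b \<in> ?B"
        with X show "orthogonal X b" unfolding tan orthogonal_def by blast
      qed
      then show ?thesis
        using X hs_inner_eq_inner[of X Z] by (simp add: tan orthogonal_def inner_commute)
    qed
    then show "Z \<in> normal_sp k H" using hS[OF Z] by (simp add: normal_sp_def)
  qed
qed

lemma cinner_mult:
  "cinner v (A *v v) = (\<Sum>i\<in>UNIV. \<Sum>j\<in>UNIV. cnj (v $ i) * (A $ i $ j * v $ j))"
  by (simp add: cinner_def matrix_vector_mult_def sum_distrib_left)

lemma psd_entry_bound: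
  fixes A :: "'n::finite oper"
  assumes "A \<in> density_ops"
  shows "norm (A $ i $ j) \<le> 1"
proof -
  have psd: "0 \<le> Re (cinner v (A *v v))" and herm: "A $ j $ i = cnj (A $ i $ j)"
    and tr: "(\<Sum>i\<in>UNIV. A $ i $ i) = 1" for v i j
    using assms by (auto simp: density_ops_def psd_op_def hermitian_op_nth trace_def)
  have q: "0 \<le> Re (A $ i $ i) + Re (w * A $ i $ j) + Re (cnj w * A $ j $ i) + Re (cnj w * (A $ j $ j * w))"
    for w i j
  proof -
    let ?v = "\<chi> p. (if p = i then 1 else 0) + (if p = j then w else 0)"
    have "cinner ?v (A *v ?v)
        = A $ i $ i + w * A $ i $ j + cnj w * A $ j $ i + cnj w * (A $ j $ j * w)"
      by (simp add: cinner_mult if_distrib[of cnj] algebra_simps sum.distrib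
          if_distrib[of "\<lambda>x. x * _"] if_distrib[of "\<lambda>x. _ * x"] cong: if_cong)
    then show ?thesis using psd[of ?v] by simp
  qed
  have d0: "0 \<le> Re (A $ p $ p)" for p
    using q[of p 0 p] by simp
  have d1: "Re (A $ p $ p) \<le> 1" for p
  proof -
    have "Re (A $ p $ p) \<le> (\<Sum>i\<in>UNIV. Re (A $ i $ i))"
      by (rule member_le_sum) (use d0 in auto)
    also have "\<dots> = Re (\<Sum>i\<in>UNIV. A $ i $ i)" by simp
    finally show ?thesis using tr by simp
  qed
  show ?thesis
  proof (cases "A $ i $ j = 0")
    case False
    define a where "a = A $ i $ j"
    define w where "w = - cnj a / complex_of_real (norm a)"
    have a: "norm a > 0" using False by (simp add: a_def)
    have "a * cnj a = complex_of_real (norm a) * complex_of_real (norm a)"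
      by (simp add: complex_norm_square[symmetric] power2_eq_square)
    then have wa: "w * a = - complex_of_real (norm a)" and ww: "w * cnj w = 1"
      using a by (auto simp: w_def divide_simps mult.commute)
    have "cnj w * A $ j $ i = cnj (w * a)" by (simp add: a_def herm[of j i])
    then have "Re (cnj w * A $ j $ i) = - norm a" using wa by simp
    moreover have "cnj w * (A $ j $ j * w) = A $ j $ j"
      using ww by (simp add: mult.commute mult.left_commute)
    moreover have "Re (w * A $ i $ j) = - norm a" using wa by (simp add: a_def)
    ultimately have "0 \<le> Re (A $ i $ i) - norm a - norm a + Re (A $ j $ j)"
      using q[of i w j] by (simp only:)
    then show ?thesis using d1[of i] d1[of j] by (simp add: a_def)
  qed simp
qed

lemma compact_feas:
  fixes H :: "nat \<Rightarrow> 'n::finite oper"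
  shows "compact (feas k H c)"
proof -
  have "norm A \<le> (\<Sum>i\<in>(UNIV::'n set). \<Sum>j\<in>(UNIV::'n set). 1)"
    if "A \<in> density_ops" for A :: "'n oper"
  proof -
    have "norm A \<le> (\<Sum>i\<in>UNIV. norm (A $ i))"
      unfolding norm_vec_def[of A] by (rule L2_set_le_sum) simp
    also have "\<dots> \<le> (\<Sum>i\<in>UNIV. \<Sum>j\<in>UNIV. norm (A $ i $ j))"
      unfolding norm_vec_def[of "A $ _"] by (intro sum_mono L2_set_le_sum) simp
    also have "\<dots> \<le> (\<Sum>i\<in>(UNIV::'n set). \<Sum>j\<in>(UNIV::'n set). 1)"
      by (intro sum_mono psd_entry_bound that)
    finally show ?thesis .
  qed
  then have "bounded (density_ops :: 'n oper set)"
    by (auto simp: bounded_iff)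
  then have "bounded (feas k H c)"
    by (rule bounded_subset) (auto simp: feas_def)
  moreover have "closed (feas k H c)"
    unfolding feas_def density_ops_def psd_op_def hermitian_op_nth cinner_mult trace_def
      matrix_matrix_mult_def Ball_def
    by (simp, intro closed_Collect_conj closed_Collect_all closed_Collect_imp
        closed_Collect_eq closed_Collect_le open_Collect_const continuous_intros)
  ultimately show ?thesis by (simp add: compact_eq_bounded_closed)
qed

text \<open>The minimum is attained and the radius is a supremum of a bounded set.\<close>

lemma min_value_attained:
  fixes H :: "nat \<Rightarrow> 'n::finite oper"
  assumes "continuous_on density_ops \<Omega>" "feas k H c \<noteq> {}"
  shows "min_value (mean_value \<Omega>) (feas k H c) \<in> mean_value \<Omega> ` feas k H c"
    and "\<And>\<sigma>. \<sigma> \<in> feas k H c \<Longrightarrow>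
            min_value (mean_value \<Omega>) (feas k H c) \<le> mean_value \<Omega> \<sigma>"
proof -
  let ?f = "mean_value \<Omega>" and ?M = "feas k H c"
  have "continuous_on ?M \<Omega>"
    by (rule continuous_on_subset[OF assms(1)]) (auto simp: feas_def)
  then have "continuous_on ?M ?f"
    unfolding mean_value_def trace_def matrix_matrix_mult_def
    by (simp, intro continuous_intros)
  then obtain s where s: "s \<in> ?M" "\<And>t. t \<in> ?M \<Longrightarrow> ?f s \<le> ?f t"
    using continuous_attains_inf[OF compact_feas assms(2)] by blast
  have "min_value ?f ?M = ?f s"
    unfolding min_value_def by (rule Least_equality) (use s in auto)
  then show "min_value ?f ?M \<in> ?f ` ?M" "\<And>\<sigma>. \<sigma> \<in> ?M \<Longrightarrow> min_value ?f ?M \<le> ?f \<sigma>"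
    using s by auto
qed

lemma bdd_above_radius:
  fixes H :: "nat \<Rightarrow> 'n::finite oper"
  assumes "hermitian_op \<rho>"
  shows "bdd_above ((\<lambda>\<sigma>. hs_norm (\<rho> - \<sigma>)) ` feas k H c)"
proof -
  obtain b where b: "\<And>\<sigma>. \<sigma> \<in> feas k H c \<Longrightarrow> norm \<sigma> \<le> b"
    using compact_imp_bounded[OF compact_feas[of k H c]] unfolding bounded_iff by blast
  have "hs_norm (\<rho> - \<sigma>) \<le> norm \<rho> + b" if s: "\<sigma> \<in> feas k H c" for \<sigma>
  proof -
    have "hermitian_op \<sigma>" using s by (simp add: feas_def density_ops_def psd_op_def)
    then show ?thesis
      using norm_triangle_ineq4[of \<rho> \<sigma>] b[OF s] hermitian_diff[OF assms]
      by (simp add: hs_norm_eq_norm)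
  qed
  then show ?thesis by (auto intro!: bdd_aboveI2)
qed

end

theory Submission imports Defs begin

text \<open>A differentiable convex function lies above its first-order expansion at \<open>\<rho>\<close>; evaluating this
  at \<open>\<rho> \<plusminus> h\<^sub>j E\<^sub>j\<close> bounds the directional derivatives \<open>Df(\<rho>)[E\<^sub>j]\<close> by the difference
  quotients. Those derivatives are the coordinates of the projection of \<open>\<nabla>f(\<rho>)\<close> onto the tangent
  space, whose norm is the distance to the normal space. The gap bound is the same convexity
  inequality at a minimiser, followed by Cauchy--Schwarz.\<close>

text \<open>On the segment from \<open>x\<close> to \<open>y\<close>, convexity bounds each
  difference quotient at \<open>x\<close> by the full chord slope \<open>f y - f x\<close>. Letting
  the parameter tend to 0 turns the quotients into \<open>D (y - x)\<close>. The derivative is only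
  relative to \<open>S\<close>, which may have empty interior.\<close>

lemma convex_on_above_derivative:
  fixes f :: "'a::real_normed_vector \<Rightarrow> real"
  assumes conv: "convex_on S f"
    and der: "(f has_derivative D) (at x within S)"
    and x: "x \<in> S" and y: "y \<in> S"
  shows "D (y - x) \<le> f y - f x"
proof -
  let ?p = "\<lambda>t::real. x + t *\<^sub>R (y - x)"
  have p_eq: "?p t = (1 - t) *\<^sub>R x + t *\<^sub>R y" for t
    by (simp add: algebra_simps)
  have seg: "?p ` {0..1} \<subseteq> S"
    using convex_on_imp_convex[OF conv] x y unfolding p_eq
    by (auto intro!: convexD)
  have lin: "linear D"
    using der by (rule has_derivative_linear)
  \<comment> \<open>Only the image of \<open>{0..1}\<close> is known to lie in \<open>S\<close>, so
    the chain rule is applied with a one-sided derivative at the endpoint 0.\<close>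
  have "(?p has_derivative (\<lambda>t. t *\<^sub>R (y - x))) (at 0 within {0..1})"
    by (auto intro!: derivative_eq_intros)
  moreover have "(f has_derivative D) (at (?p 0) within ?p ` {0..1})"
    using has_derivative_subset[OF der seg] by simp
  ultimately have "((f \<circ> ?p) has_derivative (D \<circ> (\<lambda>t. t *\<^sub>R (y - x)))) (at 0 within {0..1})"
    by (rule diff_chain_within)
  then have "((\<lambda>t. f (?p t)) has_real_derivative D (y - x)) (at 0 within {0..1})"
    by (simp add: has_field_derivative_def o_def linear_cmul[OF lin] mult.commute[of _ "D (y - x)"])
  then have lim: "((\<lambda>t. (f (?p t) - f x) / t) \<longlongrightarrow> D (y - x)) (at 0 within {0..1})"
    by (simp add: has_field_derivative_iff)
  have quot: "(f (?p t) - f x) / t \<le> f y - f x" if t: "0 < t" "t \<le> 1" for t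
  proof -
    have "f (?p t) \<le> (1 - t) * f x + t * f y"
      unfolding p_eq using t by (intro convex_onD[OF conv] x y) auto
    then show ?thesis using t by (simp add: field_simps)
  qed
  show ?thesis
  proof (rule tendsto_upperbound[OF lim])
    show "\<forall>\<^sub>F t in at 0 within {0..1}. (f (?p t) - f x) / t \<le> f y - f x"
      using quot by (auto simp: eventually_at_filter)
    \<comment> \<open>0 is a limit point of \<open>{0..1}\<close>; otherwise every value would be a
      limit and the bound would not pass to it.\<close>
    show "at (0::real) within {0..1} \<noteq> bot"
      by (simp add: trivial_limit_within islimpt_Icc)
  qed
qed

text \<open>\<open>P\<close> is the orthogonal projection onto the span of the family: the residual
  is orthogonal to each \<open>E i\<close>, hence to the span. The norm formula is Parseval's
  identity.\<close>

lemma orthonormal_projection: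
  fixes E :: "nat \<Rightarrow> 'a::real_inner"
  assumes ortho: "\<And>i j. i \<in> I \<Longrightarrow> j \<in> I \<Longrightarrow> E i \<bullet> E j = (if i = j then 1 else 0)"
    and I: "finite I"
  defines "P \<equiv> \<lambda>G. \<Sum>i\<in>I. (G \<bullet> E i) *\<^sub>R E i"
  shows "\<And>X. X \<in> span (E ` I) \<Longrightarrow> P G \<bullet> X = G \<bullet> X"
    and "norm (P G) = sqrt (\<Sum>i\<in>I. (G \<bullet> E i)\<^sup>2)"
proof -
  have coord: "P G \<bullet> E j = G \<bullet> E j" if "j \<in> I" for j
  proof -
    have "P G \<bullet> E j = (\<Sum>i\<in>I. if i = j then G \<bullet> E i else 0)"
      unfolding P_def inner_sum_left using ortho that by (auto intro!: sum.cong)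
    then show ?thesis using I that by simp
  qed
  have "orthogonal (P G - G) X" if "X \<in> span (E ` I)" for X
    by (rule orthogonal_to_span[OF that]) (auto simp: orthogonal_def inner_diff_left coord)
  then show "P G \<bullet> X = G \<bullet> X" if "X \<in> span (E ` I)" for X
    using that by (simp add: orthogonal_def inner_diff_left)
  \<comment> \<open>Only the right factor is expanded, so that \<open>coord\<close> applies to the
    remaining \<open>P G \<bullet> E i\<close>.\<close>
  have "P G \<bullet> P G = (\<Sum>i\<in>I. (G \<bullet> E i) * (P G \<bullet> E i))"
    by (subst (2) P_def) (simp add: inner_sum_right)
  also have "\<dots> = (\<Sum>i\<in>I. (G \<bullet> E i)\<^sup>2)"
    by (simp add: coord power2_eq_square)
  finally show "norm (P G) = sqrt (\<Sum>i\<in>I. (G \<bullet> E i)\<^sup>2)"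
    by (simp add: norm_eq_sqrt_inner)
qed

lemma feas_hermitian: "\<sigma> \<in> feas k H c \<Longrightarrow> hermitian_op \<sigma>"
  by (simp add: feas_def density_ops_def psd_op_def)

lemma feas_diff_tangent:
  fixes H :: "nat \<Rightarrow> 'n::finite oper"
  assumes "\<rho> \<in> feas k H c" "\<sigma> \<in> feas k H c"
  shows "\<rho> - \<sigma> \<in> tangent k H"
proof -
  have "(\<rho> - \<sigma>) ** B = \<rho> ** B - \<sigma> ** B" for B :: "'n oper"
    by (simp add: vec_eq_iff matrix_matrix_mult_def left_diff_distrib sum_subtractf)
  then show ?thesis
    using assms feas_hermitian[OF assms(1)] feas_hermitian[OF assms(2)]
    by (simp add: tangent_def hermitian_diff trace_sub feas_def density_ops_def)
qed

text \<open>On Hermitian operators \<open>hs_norm\<close> is a genuine norm, so 0 bounds the set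
  below and its infimum is at most each member.\<close>

lemma dist2_le_hs_norm:
  assumes "hermitian_op Y" "Z \<in> N" "\<And>Z. Z \<in> N \<Longrightarrow> hermitian_op Z"
  shows "dist2 Y N \<le> hs_norm (Y - Z)"
  unfolding dist2_def
proof (rule cINF_lower[OF _ assms(2)])
  show "bdd_below ((\<lambda>Z. hs_norm (Y - Z)) ` N)"
    using assms by (intro bdd_belowI2[of _ 0]) (simp add: hs_norm_eq_norm hermitian_diff)
qed

theorem theorem16:
  fixes k m :: nat
    and H E :: "nat \<Rightarrow> 'n::finite oper"
    and c h :: "nat \<Rightarrow> real"
    and \<Omega> gradf :: "'n oper \<Rightarrow> 'n oper"
    and \<rho> :: "'n oper"
  assumes H_herm: "\<And>j. j \<in> {1..k} \<Longrightarrow> hermitian_op (H j)"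
    and H_indep: "lin_indep_family k H"
    and feas_pd_nonempty: "feas_pd k H c \<noteq> {}"
    and Omega_cont: "continuous_on density_ops \<Omega>"
    and Omega_herm: "\<And>\<sigma>. \<sigma> \<in> density_ops \<Longrightarrow> hermitian_op (\<Omega> \<sigma>)"
    and f_convex: "convex_on (feas k H c) (mean_value \<Omega>)"
    and f_grad: "\<And>\<sigma>. \<sigma> \<in> feas k H c \<Longrightarrow>
                    has_gradient_in (mean_value \<Omega>) (gradf \<sigma>) \<sigma> (feas k H c)"
    and E_basis: "hs_orthonormal_basis m E (tangent k H)"
    and rho: "\<rho> \<in> feas_pd k H c"
    and h_pos: "\<And>j. j \<in> {1..m} \<Longrightarrow> 0 < h j"
    and h_plus: "\<And>j. j \<in> {1..m} \<Longrightarrow> \<rho> + h j *\<^sub>R E j \<in> feas k H c"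
    and h_minus: "\<And>j. j \<in> {1..m} \<Longrightarrow> \<rho> - h j *\<^sub>R E j \<in> feas k H c"
  shows "(\<forall>j\<in>{1..m}. lower_quot (mean_value \<Omega>) \<rho> (h j) (E j) \<le> hs_inner (gradf \<rho>) (E j) \<and>
                      hs_inner (gradf \<rho>) (E j) \<le> upper_quot (mean_value \<Omega>) \<rho> (h j) (E j)) \<and>
         dist2 (gradf \<rho>) (normal_sp k H)
           \<le> sqrt (\<Sum>j=1..m. (quot_bound (mean_value \<Omega>) \<rho> (h j) (E j))\<^sup>2) \<and>
         0 \<le> mean_value \<Omega> \<rho> - min_value (mean_value \<Omega>) (feas k H c) \<and>
         mean_value \<Omega> \<rho> - min_value (mean_value \<Omega>) (feas k H c)
           \<le> radius2 \<rho> (feas k H c) *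
              sqrt (\<Sum>j=1..m. (quot_bound (mean_value \<Omega>) \<rho> (h j) (E j))\<^sup>2)"
proof -
  let ?f = "mean_value \<Omega>" and ?M = "feas k H c" and ?G = "gradf \<rho>"
  let ?\<beta> = "\<lambda>j. quot_bound ?f \<rho> (h j) (E j)"
  let ?B = "sqrt (\<Sum>j=1..m. (?\<beta> j)\<^sup>2)"
  define P where "P = (\<Sum>j=1..m. (?G \<bullet> E j) *\<^sub>R E j)"
  have rhoM: "\<rho> \<in> ?M"
    using rho by (simp add: feas_pd_def)
  have G: "hermitian_op ?G" and der: "(?f has_derivative hs_inner ?G) (at \<rho> within ?M)"
    using f_grad[OF rhoM] by (simp_all add: has_gradient_in_def)
  have tangent_herm: "hermitian_op X" if "X \<in> tangent k H" for X
    using that by (simp add: tangent_def)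
  have ET: "E j \<in> tangent k H" if "j \<in> {1..m}" for j
    using E_basis that by (simp add: hs_orthonormal_basis_def)
  have spanE: "span (E ` {1..m}) = tangent k H"
    using E_basis by (simp add: hs_orthonormal_basis_def)
  have orthoE: "E i \<bullet> E j = (if i = j then 1 else 0)" if "i \<in> {1..m}" "j \<in> {1..m}" for i j
    using E_basis that hs_inner_eq_inner[OF tangent_herm[OF ET[OF that(2)]], of "E i"]
    unfolding hs_orthonormal_basis_def by metis
  have proj: "P \<bullet> X = ?G \<bullet> X" if "X \<in> tangent k H" for X
    unfolding P_def by (rule orthonormal_projection(1)) (use orthoE that spanE in auto)
  have normP: "norm P = sqrt (\<Sum>j=1..m. (?G \<bullet> E j)\<^sup>2)"
    unfolding P_def by (rule orthonormal_projection(2)) (use orthoE in auto)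
  have PT: "P \<in> tangent k H"
    unfolding P_def spanE[symmetric] by (intro span_sum span_scale span_base) auto
  have grad: "hs_inner ?G X = ?G \<bullet> X" if "X \<in> tangent k H" for X
    using that by (simp add: hs_inner_eq_inner tangent_herm)
  have above: "?G \<bullet> (\<sigma> - \<rho>) \<le> ?f \<sigma> - ?f \<rho>" if "\<sigma> \<in> ?M" for \<sigma>
    using convex_on_above_derivative[OF f_convex der rhoM that]
    by (simp add: grad feas_diff_tangent[OF that rhoM])
  \<comment> \<open>The displacements from \<open>\<rho>\<close> are
    \<open>h j *\<^sub>R E j\<close> and its negative: the first gives the upper quotient, the
    second, after a sign change, the lower one.\<close>
  have quot: "lower_quot ?f \<rho> (h j) (E j) \<le> ?G \<bullet> E j \<and> ?G \<bullet> E j \<le> upper_quot ?f \<rho> (h j) (E j)"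
    if j: "j \<in> {1..m}" for j
    using above[OF h_plus[OF j]] above[OF h_minus[OF j]] h_pos[OF j]
    by (simp add: lower_quot_def upper_quot_def field_simps)
  \<comment> \<open>A number between two reals is at most the larger of their absolute values in
    modulus.\<close>
  have "\<bar>?G \<bullet> E j\<bar> \<le> ?\<beta> j" if "j \<in> {1..m}" for j
    using quot[OF that] by (auto simp: quot_bound_def)
  then have "(?G \<bullet> E j)\<^sup>2 \<le> (?\<beta> j)\<^sup>2" if "j \<in> {1..m}" for j
    using that power_mono[of "\<bar>?G \<bullet> E j\<bar>" "?\<beta> j" 2] by simp
  then have PB: "norm P \<le> ?B"
    unfolding normP by (intro real_sqrt_le_mono sum_mono)
  \<comment> \<open>The residual \<open>?G - P\<close> is a competitor in the infimum, at distance
    \<open>norm P\<close> from \<open>?G\<close>. Its optimality is not at issue, since only an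
    upper bound is claimed.\<close>
  have "?G - P \<in> normal_sp k H"
    using hs_inner_eq_inner[OF tangent_herm] proj
    by (simp add: normal_sp_def hermitian_diff[OF G tangent_herm[OF PT]] inner_diff_left)
  then have "dist2 ?G (normal_sp k H) \<le> hs_norm (?G - (?G - P))"
    by (rule dist2_le_hs_norm[OF G]) (simp add: normal_sp_def)
  then have dist: "dist2 ?G (normal_sp k H) \<le> ?B"
    using PB by (simp add: hs_norm_eq_norm tangent_herm[OF PT])
  have ne: "?M \<noteq> {}" using rhoM by auto
  obtain \<sigma> where s: "\<sigma> \<in> ?M" and min: "min_value ?f ?M = ?f \<sigma>"
    using min_value_attained(1)[OF Omega_cont ne] by auto
  have sT: "\<rho> - \<sigma> \<in> tangent k H" by (rule feas_diff_tangent[OF rhoM s])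
  have "norm (\<rho> - \<sigma>) = hs_norm (\<rho> - \<sigma>)"
    by (simp add: hs_norm_eq_norm tangent_herm[OF sT])
  also have "\<dots> \<le> radius2 \<rho> ?M"
    unfolding radius2_def
    by (rule cSUP_upper[OF s bdd_above_radius[OF feas_hermitian[OF rhoM]]])
  finally have R: "norm (\<rho> - \<sigma>) \<le> radius2 \<rho> ?M" .
  \<comment> \<open>Since \<open>\<rho> - \<sigma>\<close> is tangent, \<open>?G\<close> may be
    replaced by \<open>P\<close> before Cauchy-Schwarz. This brings in \<open>norm P\<close>, which
    \<open>?B\<close> bounds, instead of the norm of the full gradient, whose normal component is
    arbitrary.\<close>
  have "?f \<rho> - ?f \<sigma> \<le> P \<bullet> (\<rho> - \<sigma>)"
    using above[OF s] unfolding proj[OF sT] by (simp add: inner_diff_right)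
  also have "\<dots> \<le> norm P * norm (\<rho> - \<sigma>)"
    by (rule norm_cauchy_schwarz)
  also have "\<dots> \<le> ?B * radius2 \<rho> ?M"
    by (rule mult_mono[OF PB R]) (simp_all add: sum_nonneg)
  finally have gap: "?f \<rho> - min_value ?f ?M \<le> radius2 \<rho> ?M * ?B"
    by (simp add: min mult.commute)
  have nonneg: "0 \<le> ?f \<rho> - min_value ?f ?M"
    using min_value_attained(2)[OF Omega_cont ne rhoM] by simp
  show ?thesis
    using quot dist gap nonneg by (simp add: grad ET)
qed

end
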